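(* Let $X$ be a set with a distance $\mathbf{d}$ and let $Y\subseteq X$. Suppose that $X=Y^{\mathsf{C}}$ and that $\mathbf{d}(y,x_\lambda)\to\mathbf{d}(y,x)$ whenever $y\in Y$, $(x_\lambda)\subseteq Y$ is a $\mathbf{d}$-Cauchy net and $x\in X$ is an $X^\circ_\circ$-limit of $(x_\lambda)$. Then $Y\subseteq X^{\mathsf{F}}$, and hence $X$ is $\mathbf{d}$-algebraic.
   Context: A distance on a set $X$ is a function $\mathbf{d}:X\times X\to[0,\infty]$ satisfying the triangle inequality $\mathbf{d}(x,y)\leq\mathbf{d}(x,z)+\mathbf{d}(z,y)$ for all $x,y,z\in X$ (no symmetry, and $\mathbf{d}(x,x)=0$ is not required). A net is a family indexed by a (nonempty) set $\Lambda$ with a transitive, possibly non-reflexive, relation $\prec$ such that for all $\gamma,\delta\in\Lambda$ there is $\lambda\in\Lambda$ with $\gamma,\delta\prec\lambda$; $\liminf_\lambda r_\lambda=\lim_\gamma\inf_{\gamma\prec\lambda}r_\lambda$ and $\limsup_\lambda r_\lambda=\lim_\gamma\sup_{\gamma\prec\lambda}r_\lambda$. A net $(x_\lambda)\subseteq X$ is $\mathbf{d}$-Cauchy if $\lim_\gamma\sup_{\gamma\prec\delta}\mathbf{d}(x_\gamma,x_\delta)=0$. An element $x\in X$ is an $X^\circ_\circ$-limit of $(x_\lambda)$ if for all $c\in X$ both $\liminf_\lambda\mathbf{d}(x_\lambda,c)\geq\mathbf{d}(x,c)$ and $\liminf_\lambda\mathbf{d}(c,x_\lambda)\geq\mathbf{d}(c,x)$.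 For $Y\subseteq X$, $Y^{\mathsf{C}}$ denotes the set of all $X^\circ_\circ$-limits in $X$ of $\mathbf{d}$-Cauchy nets in $Y$. The set $X^{\mathsf{F}}$ of $\mathbf{d}$-finite elements of $X$ consists of all $y\in X$ such that $\mathbf{d}(y,x_\lambda)\to\mathbf{d}(y,x)$ whenever $(x_\lambda)\subseteq X$ is $\mathbf{d}$-Cauchy and $x\in X$ is an $X^\circ_\circ$-limit of $(x_\lambda)$. $X$ is $\mathbf{d}$-algebraic if $X=(X^{\mathsf{F}})^{\mathsf{C}}$. *)

theory Defs
  imports "HOL-Analysis.Analysis"
begin

definition distance_on :: "'a set \<Rightarrow> ('a \<Rightarrow> 'a \<Rightarrow> ennreal) \<Rightarrow> bool" where
  "distance_on X d \<longleftrightarrow> (\<forall>x\<in>X. \<forall>y\<in>X. \<forall>z\<in>X. d x y \<le> d x z + d z y)"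

text \<open>
  The relation of a net need not be reflexive. A net is a function \<open>u\<close> on an index set
  \<open>\<Lambda>\<close>; values of \<open>u\<close> outside \<open>\<Lambda>\<close> are irrelevant.
\<close>

definition net_index_set :: "'i set \<Rightarrow> ('i \<Rightarrow> 'i \<Rightarrow> bool) \<Rightarrow> bool" where
  "net_index_set \<Lambda> R \<longleftrightarrow>
     \<Lambda> \<noteq> {} \<and> transp_on \<Lambda> R \<and> (\<forall>\<gamma>\<in>\<Lambda>. \<forall>\<delta>\<in>\<Lambda>. \<exists>l\<in>\<Lambda>. R \<gamma> l \<and> R \<delta> l)"

definition net_succs :: "'i set \<Rightarrow> ('i \<Rightarrow> 'i \<Rightarrow> bool) \<Rightarrow> 'i \<Rightarrow> 'i set" where
  "net_succs \<Lambda> R \<gamma> = {l \<in> \<Lambda>. R \<gamma> l}"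

definition net_filter :: "'i set \<Rightarrow> ('i \<Rightarrow> 'i \<Rightarrow> bool) \<Rightarrow> 'i filter" where
  "net_filter \<Lambda> R = (INF \<gamma>\<in>\<Lambda>. principal (net_succs \<Lambda> R \<gamma>))"

definition net_cauchy ::
  "('a \<Rightarrow> 'a \<Rightarrow> ennreal) \<Rightarrow> 'i set \<Rightarrow> ('i \<Rightarrow> 'i \<Rightarrow> bool) \<Rightarrow> ('i \<Rightarrow> 'a) \<Rightarrow> bool" where
  "net_cauchy d \<Lambda> R u \<longleftrightarrow>
     ((\<lambda>\<gamma>. SUP \<delta>\<in>net_succs \<Lambda> R \<gamma>. d (u \<gamma>) (u \<delta>)) \<longlongrightarrow> 0) (net_filter \<Lambda> R)"

definition net_limit ::
  "'a set \<Rightarrow> ('a \<Rightarrow> 'a \<Rightarrow> ennreal) \<Rightarrow> 'i set \<Rightarrow> ('i \<Rightarrow> 'i \<Rightarrow> bool) \<Rightarrow> ('i \<Rightarrow> 'a) \<Rightarrow> 'a \<Rightarrow> bool"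
where
  "net_limit X d \<Lambda> R u x \<longleftrightarrow> x \<in> X \<and>
     (\<forall>c\<in>X. Liminf (net_filter \<Lambda> R) (\<lambda>l. d (u l) c) \<ge> d x c \<and>
            Liminf (net_filter \<Lambda> R) (\<lambda>l. d c (u l)) \<ge> d c x)"

text \<open>
  HOL cannot quantify over the type of the index set inside a formula. The definitions below
  quantify over nets indexed by subsets of the following type. This is no restriction: by
  \<open>cauchy_net_reindex\<close> every Cauchy net, indexed by whatever type, can be replaced by one
  indexed by this type that has the same values and the same convergence behaviour.
  An index \<open>\<gamma>\<close> is represented by its value, the set of values at its successors, and two
  numbers measuring the oscillation at \<open>\<gamma>\<close> and beyond it.
\<close>

type_synonym 'a net_index = "'a \<times> 'a set \<times> ennreal \<times> ennreal"

definition cauchy_limits :: "'a set \<Rightarrow> ('a \<Rightarrow> 'a \<Rightarrow> ennreal) \<Rightarrow> 'a set \<Rightarrow> 'a set" where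
  "cauchy_limits X d Y =
     {x. \<exists>(\<Lambda> :: 'a net_index set) R u. net_index_set \<Lambda> R \<and> u ` \<Lambda> \<subseteq> Y \<and>
           net_cauchy d \<Lambda> R u \<and> net_limit X d \<Lambda> R u x}"

definition finite_elements :: "'a set \<Rightarrow> ('a \<Rightarrow> 'a \<Rightarrow> ennreal) \<Rightarrow> 'a set" where
  "finite_elements X d =
     {y \<in> X. \<forall>(\<Lambda> :: 'a net_index set) R u x. net_index_set \<Lambda> R \<longrightarrow> u ` \<Lambda> \<subseteq> X \<longrightarrow>
           net_cauchy d \<Lambda> R u \<longrightarrow> net_limit X d \<Lambda> R u x \<longrightarrow>
           ((\<lambda>l. d y (u l)) \<longlongrightarrow> d y x) (net_filter \<Lambda> R)}"

definition algebraic_on :: "'a set \<Rightarrow> ('a \<Rightarrow> 'a \<Rightarrow> ennreal) \<Rightarrow> bool" where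
  "algebraic_on X d \<longleftrightarrow> X = cauchy_limits X d (finite_elements X d)"


lemma eventually_net_filter:
  assumes "net_index_set \<Lambda> R"
  shows "eventually P (net_filter \<Lambda> R) \<longleftrightarrow> (\<exists>\<gamma>\<in>\<Lambda>. \<forall>l\<in>net_succs \<Lambda> R \<gamma>. P l)"
proof -
  have tr: "R a c" if "R a b" "R b c" "a \<in> \<Lambda>" "b \<in> \<Lambda>" "c \<in> \<Lambda>" for a b c
    using assms that unfolding net_index_set_def transp_on_def by blast
  have "\<exists>l\<in>\<Lambda>. net_succs \<Lambda> R l \<subseteq> net_succs \<Lambda> R a \<inter> net_succs \<Lambda> R b"
    if ab: "a \<in> \<Lambda>" "b \<in> \<Lambda>" for a b
  proof -
    obtain l where "l \<in> \<Lambda>" "R a l" "R b l"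
      using assms ab unfolding net_index_set_def by blast
    then show ?thesis using ab by (intro bexI[of _ l]) (auto simp: net_succs_def intro: tr)
  qed
  moreover have "\<Lambda> \<noteq> {}" using assms by (simp add: net_index_set_def)
  ultimately show ?thesis
    unfolding net_filter_def
    by (subst eventually_INF_base) (auto simp: eventually_principal)
qed

text \<open>The library's \<open>Liminf\<close> along \<open>net_filter\<close> is the usual limit of tail infima.\<close>

lemma Liminf_net_filter:
  fixes r :: "'i \<Rightarrow> ennreal"
  assumes "net_index_set \<Lambda> R"
  shows "Liminf (net_filter \<Lambda> R) r = (SUP \<gamma>\<in>\<Lambda>. INF l\<in>net_succs \<Lambda> R \<gamma>. r l)"
    and "((\<lambda>\<gamma>. INF l\<in>net_succs \<Lambda> R \<gamma>. r l) \<longlongrightarrow> Liminf (net_filter \<Lambda> R) r) (net_filter \<Lambda> R)"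
proof -
  show eq: "Liminf (net_filter \<Lambda> R) r = (SUP \<gamma>\<in>\<Lambda>. INF l\<in>net_succs \<Lambda> R \<gamma>. r l)"
    unfolding Liminf_def eventually_net_filter[OF assms]
  proof (rule SUP_eq)
    fix P assume "P \<in> {P. \<exists>\<gamma>\<in>\<Lambda>. \<forall>l\<in>net_succs \<Lambda> R \<gamma>. P l}"
    then obtain \<gamma> where "\<gamma> \<in> \<Lambda>" "\<forall>l\<in>net_succs \<Lambda> R \<gamma>. P l" by blast
    then show "\<exists>\<gamma>\<in>\<Lambda>. Inf (r ` Collect P) \<le> (INF l\<in>net_succs \<Lambda> R \<gamma>. r l)"
      by (intro bexI[of _ \<gamma>] INF_superset_mono) auto
  next
    fix \<gamma> assume "\<gamma> \<in> \<Lambda>"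
    then show "\<exists>P\<in>{P. \<exists>\<gamma>\<in>\<Lambda>. \<forall>l\<in>net_succs \<Lambda> R \<gamma>. P l}.
        (INF l\<in>net_succs \<Lambda> R \<gamma>. r l) \<le> Inf (r ` Collect P)"
      by (intro bexI[of _ "\<lambda>l. l \<in> net_succs \<Lambda> R \<gamma>"]) auto
  qed
  show "((\<lambda>\<gamma>. INF l\<in>net_succs \<Lambda> R \<gamma>. r l) \<longlongrightarrow> Liminf (net_filter \<Lambda> R) r) (net_filter \<Lambda> R)"
  proof (rule order_tendstoI)
    fix a assume "a < Liminf (net_filter \<Lambda> R) r"
    then obtain \<gamma> where g: "\<gamma> \<in> \<Lambda>" "a < (INF l\<in>net_succs \<Lambda> R \<gamma>. r l)"
      unfolding eq less_SUP_iff by blast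
    have "(INF l\<in>net_succs \<Lambda> R \<gamma>. r l) \<le> (INF l\<in>net_succs \<Lambda> R \<delta>. r l)"
      if "\<delta> \<in> net_succs \<Lambda> R \<gamma>" for \<delta>
    proof (rule INF_superset_mono)
      show "net_succs \<Lambda> R \<delta> \<subseteq> net_succs \<Lambda> R \<gamma>"
        using assms that g(1) unfolding net_succs_def net_index_set_def transp_on_def by blast
    qed simp
    then show "\<forall>\<^sub>F \<gamma> in net_filter \<Lambda> R. a < (INF l\<in>net_succs \<Lambda> R \<gamma>. r l)"
      unfolding eventually_net_filter[OF assms] using g less_le_trans by blast
  next
    fix a assume a: "Liminf (net_filter \<Lambda> R) r < a"
    have "(INF l\<in>net_succs \<Lambda> R \<gamma>. r l) < a" if "\<gamma> \<in> \<Lambda>" for \<gamma>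
      using a that unfolding eq by (meson SUP_upper le_less_trans)
    moreover obtain \<gamma> where "\<gamma> \<in> \<Lambda>" using assms unfolding net_index_set_def by blast
    ultimately show "\<forall>\<^sub>F \<gamma> in net_filter \<Lambda> R. (INF l\<in>net_succs \<Lambda> R \<gamma>. r l) < a"
      unfolding eventually_net_filter[OF assms] net_succs_def by blast
  qed
qed

lemma cauchy_net_reindex:
  fixes \<Lambda> :: "'i set" and u :: "'i \<Rightarrow> 'a" and d :: "'a \<Rightarrow> 'a \<Rightarrow> ennreal"
  assumes net: "net_index_set \<Lambda> R" and cauchy: "net_cauchy d \<Lambda> R u"
  obtains \<Lambda>' :: "'a net_index set" and R' u' where
    "net_index_set \<Lambda>' R'" "net_cauchy d \<Lambda>' R' u'" "u' ` \<Lambda>' = u ` \<Lambda>"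
    "filtermap u' (net_filter \<Lambda>' R') = filtermap u (net_filter \<Lambda> R)"
proof -
  define T where "T \<gamma> = u ` net_succs \<Lambda> R \<gamma>" for \<gamma>
  define r where "r \<gamma> = (SUP \<delta>\<in>net_succs \<Lambda> R \<gamma>. d (u \<gamma>) (u \<delta>))" for \<gamma>
  define s where "s \<gamma> = (SUP \<delta>\<in>net_succs \<Lambda> R \<gamma>. r \<delta>)" for \<gamma>
  define J where "J \<gamma> = (u \<gamma>, T \<gamma>, r \<gamma>, s \<gamma>)" for \<gamma>
  define Q :: "'a net_index \<Rightarrow> 'a net_index \<Rightarrow> bool" where
    "Q = (\<lambda>(x, A, a, b) (x', A', a', b'). x' \<in> A \<and> A' \<subseteq> A \<and> a' \<le> b \<and> b' \<le> b)"
  have QJ: "Q (J \<gamma>) (J \<delta>) \<longleftrightarrow> u \<delta> \<in> T \<gamma> \<and> T \<delta> \<subseteq> T \<gamma> \<and> r \<delta> \<le> s \<gamma> \<and> s \<delta> \<le> s \<gamma>" for \<gamma> \<delta>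
    by (simp add: Q_def J_def)
  have sub: "net_succs \<Lambda> R \<delta> \<subseteq> net_succs \<Lambda> R \<gamma>" if "\<gamma> \<in> \<Lambda>" "\<delta> \<in> net_succs \<Lambda> R \<gamma>" for \<gamma> \<delta>
    using net that unfolding net_succs_def net_index_set_def transp_on_def by blast
  have step: "Q (J \<gamma>) (J \<delta>)" if "\<gamma> \<in> \<Lambda>" "\<delta> \<in> net_succs \<Lambda> R \<gamma>" for \<gamma> \<delta>
    unfolding QJ T_def s_def using that sub[OF that]
    by (auto intro: SUP_upper SUP_subset_mono)
  have net': "net_index_set (J ` \<Lambda>) Q"
    unfolding net_index_set_def
  proof (intro conjI ballI)
    show "J ` \<Lambda> \<noteq> {}" using net by (simp add: net_index_set_def)
    show "transp_on (J ` \<Lambda>) Q"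
      unfolding transp_on_def ball_simps QJ by (blast intro: order_trans)
    fix a b assume "a \<in> J ` \<Lambda>" "b \<in> J ` \<Lambda>"
    then obtain \<gamma> \<delta> where ab: "\<gamma> \<in> \<Lambda>" "a = J \<gamma>" "\<delta> \<in> \<Lambda>" "b = J \<delta>" by blast
    with net obtain l where "l \<in> \<Lambda>" "R \<gamma> l" "R \<delta> l"
      unfolding net_index_set_def by blast
    with ab step show "\<exists>l\<in>J ` \<Lambda>. Q a l \<and> Q b l"
      by (auto simp: net_succs_def)
  qed
  have tail: "fst ` net_succs (J ` \<Lambda>) Q (J \<gamma>) = u ` net_succs \<Lambda> R \<gamma>" if "\<gamma> \<in> \<Lambda>" for \<gamma>
  proof
    show "fst ` net_succs (J ` \<Lambda>) Q (J \<gamma>) \<subseteq> u ` net_succs \<Lambda> R \<gamma>"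
    proof
      fix z assume "z \<in> fst ` net_succs (J ` \<Lambda>) Q (J \<gamma>)"
      then obtain \<delta> where "Q (J \<gamma>) (J \<delta>)" "z = fst (J \<delta>)"
        unfolding net_succs_def by blast
      then show "z \<in> u ` net_succs \<Lambda> R \<gamma>"
        unfolding QJ by (simp add: J_def T_def)
    qed
    show "u ` net_succs \<Lambda> R \<gamma> \<subseteq> fst ` net_succs (J ` \<Lambda>) Q (J \<gamma>)"
    proof
      fix z assume "z \<in> u ` net_succs \<Lambda> R \<gamma>"
      then obtain \<delta> where d: "\<delta> \<in> net_succs \<Lambda> R \<gamma>" "z = u \<delta>" by blast
      with step[OF that] have "J \<delta> \<in> net_succs (J ` \<Lambda>) Q (J \<gamma>)"
        by (auto simp: net_succs_def)
      then show "z \<in> fst ` net_succs (J ` \<Lambda>) Q (J \<gamma>)"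
        using d(2) by (force simp: J_def)
    qed
  qed
  have filt: "filtermap fst (net_filter (J ` \<Lambda>) Q) = filtermap u (net_filter \<Lambda> R)"
  proof (rule filter_eqI)
    fix P
    have "(\<forall>l\<in>net_succs (J ` \<Lambda>) Q (J \<gamma>). P (fst l)) \<longleftrightarrow> (\<forall>l\<in>net_succs \<Lambda> R \<gamma>. P (u l))"
      if "\<gamma> \<in> \<Lambda>" for \<gamma>
      using tail[OF that] by (metis (no_types, opaque_lifting) imageE imageI)
    then show "eventually P (filtermap fst (net_filter (J ` \<Lambda>) Q)) =
        eventually P (filtermap u (net_filter \<Lambda> R))"
      unfolding eventually_filtermap eventually_net_filter[OF net] eventually_net_filter[OF net']
      by simp
  qed
  have cauchy': "net_cauchy d (J ` \<Lambda>) Q fst"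
    unfolding net_cauchy_def
  proof (rule order_tendstoI)
    fix e :: ennreal assume "0 < e"
    then obtain e' where e': "0 < e'" "e' < e" using dense by blast
    have "(r \<longlongrightarrow> 0) (net_filter \<Lambda> R)"
      using cauchy unfolding net_cauchy_def r_def .
    from order_tendstoD(2)[OF this e'(1)]
    obtain \<gamma> where g: "\<gamma> \<in> \<Lambda>" "\<forall>l\<in>net_succs \<Lambda> R \<gamma>. r l < e'"
      unfolding eventually_net_filter[OF net] by blast
    then have s: "s \<gamma> \<le> e'" unfolding s_def by (intro SUP_least) (simp add: less_imp_le)
    have "(SUP m\<in>net_succs (J ` \<Lambda>) Q l. d (fst l) (fst m)) < e"
      if l: "l \<in> net_succs (J ` \<Lambda>) Q (J \<gamma>)" for l
    proof -
      obtain \<delta> where d: "\<delta> \<in> \<Lambda>" "l = J \<delta>" "Q (J \<gamma>) (J \<delta>)"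
        using l unfolding net_succs_def by blast
      have "(SUP m\<in>net_succs (J ` \<Lambda>) Q l. d (fst l) (fst m))
          = (SUP z\<in>fst ` net_succs (J ` \<Lambda>) Q (J \<delta>). d (u \<delta>) z)"
        by (simp add: d(2) image_image) (simp add: J_def)
      also have "\<dots> = r \<delta>" unfolding tail[OF d(1)] r_def by (simp add: image_image)
      also have "\<dots> \<le> s \<gamma>" using d(3) unfolding QJ by blast
      finally show ?thesis using s e'(2) by order
    qed
    then show "\<forall>\<^sub>F l in net_filter (J ` \<Lambda>) Q.
        (SUP m\<in>net_succs (J ` \<Lambda>) Q l. d (fst l) (fst m)) < e"
      unfolding eventually_net_filter[OF net'] using g(1) by blast
  qed simp
  have "fst ` J ` \<Lambda> = u ` \<Lambda>" by (simp add: image_image J_def)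
  from that[OF net' cauchy' this filt] show thesis .
qed

lemma net_limit_filtermap:
  assumes "filtermap u' (net_filter \<Lambda>' R') = filtermap u (net_filter \<Lambda> R)"
  shows "net_limit X d \<Lambda>' R' u' x \<longleftrightarrow> net_limit X d \<Lambda> R u x"
proof -
  have ev: "eventually (\<lambda>l. P (u' l)) (net_filter \<Lambda>' R') \<longleftrightarrow> eventually (\<lambda>l. P (u l)) (net_filter \<Lambda> R)"
    for P using assms by (metis eventually_filtermap)
  have "(\<forall>\<^sub>F l in net_filter \<Lambda>' R'. a < d (u' l) c) \<longleftrightarrow> (\<forall>\<^sub>F l in net_filter \<Lambda> R. a < d (u l) c)"
    "(\<forall>\<^sub>F l in net_filter \<Lambda>' R'. a < d c (u' l)) \<longleftrightarrow> (\<forall>\<^sub>F l in net_filter \<Lambda> R. a < d c (u l))"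
    for a c using ev[of "\<lambda>z. a < d z c"] ev[of "\<lambda>z. a < d c z"] by simp_all
  then show ?thesis unfolding net_limit_def le_Liminf_iff by simp
qed

text \<open>
  Hence \<open>cauchy_limits\<close> and \<open>finite_elements\<close> have the expected meaning for nets over
  arbitrary index types.
\<close>

lemma cauchy_limitsI:
  fixes \<Lambda> :: "'i set" and u :: "'i \<Rightarrow> 'a"
  assumes "net_index_set \<Lambda> R" "u ` \<Lambda> \<subseteq> Y" "net_cauchy d \<Lambda> R u" "net_limit X d \<Lambda> R u x"
  shows "x \<in> cauchy_limits X d Y"
proof -
  obtain \<Lambda>' :: "'a net_index set" and R' u' where
    "net_index_set \<Lambda>' R'" "net_cauchy d \<Lambda>' R' u'" "u' ` \<Lambda>' = u ` \<Lambda>"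
    "filtermap u' (net_filter \<Lambda>' R') = filtermap u (net_filter \<Lambda> R)"
    using cauchy_net_reindex[OF assms(1,3)] .
  with assms net_limit_filtermap[OF this(4)] show ?thesis
    unfolding cauchy_limits_def by (metis (mono_tags, lifting) mem_Collect_eq)
qed

text \<open>
  With \<open>Z = X\<close> this concerns the defining property of \<open>finite_elements\<close>; it applies equally
  to convergence hypotheses about nets in a smaller set \<open>Z\<close>.
\<close>

lemma tendsto_cauchy_nets_any_index:
  fixes \<Lambda> :: "'i set" and u :: "'i \<Rightarrow> 'a"
  assumes "\<And>(\<Lambda> :: 'a net_index set) R u x. net_index_set \<Lambda> R \<Longrightarrow> u ` \<Lambda> \<subseteq> Z \<Longrightarrow>
      net_cauchy d \<Lambda> R u \<Longrightarrow> net_limit X d \<Lambda> R u x \<Longrightarrow>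
      ((\<lambda>l. d y (u l)) \<longlongrightarrow> d y x) (net_filter \<Lambda> R)"
    and "net_index_set \<Lambda> R" "u ` \<Lambda> \<subseteq> Z" "net_cauchy d \<Lambda> R u" "net_limit X d \<Lambda> R u x"
  shows "((\<lambda>l. d y (u l)) \<longlongrightarrow> d y x) (net_filter \<Lambda> R)"
proof -
  obtain \<Lambda>' :: "'a net_index set" and R' u' where N:
    "net_index_set \<Lambda>' R'" "net_cauchy d \<Lambda>' R' u'" "u' ` \<Lambda>' = u ` \<Lambda>"
    "filtermap u' (net_filter \<Lambda>' R') = filtermap u (net_filter \<Lambda> R)"
    using cauchy_net_reindex[OF assms(2,4)] .
  have "((\<lambda>l. d y (u' l)) \<longlongrightarrow> d y x) (net_filter \<Lambda>' R')"
    using assms(1)[OF N(1) _ N(2)] N(3) assms(3,5) net_limit_filtermap[OF N(4)] by metis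
  then have "((\<lambda>z. d y z) \<longlongrightarrow> d y x) (filtermap u' (net_filter \<Lambda>' R'))"
    by (simp add: filterlim_filtermap)
  then show ?thesis unfolding N(4) by (simp add: filterlim_filtermap)
qed

end

theory Submission
  imports Defs
begin

text \<open>
  Fix \<open>y \<in> Y\<close> and a Cauchy net \<open>(x\<^sub>\<lambda>)\<close> in \<open>X\<close> with limit \<open>x\<close>. Being a limit already gives
  \<open>liminf d(y, x\<^sub>\<lambda>) \<ge> d(y, x)\<close>, so only the upper bound on \<open>limsup d(y, x\<^sub>\<lambda>)\<close> is at stake. It would
  follow from \<open>d(y, x\<^sub>\<lambda>) \<le> d(y, v) + d(v, x\<^sub>\<lambda>)\<close> if some \<open>v \<in> Y\<close> had \<open>d(y, v)\<close> close to \<open>d(y, x)\<close>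
  and \<open>d(v, x\<^sub>\<lambda>)\<close> eventually small. The continuity hypothesis speaks only of nets in \<open>Y\<close>, so the
  task is to replace \<open>(x\<^sub>\<lambda>)\<close> by a Cauchy net in \<open>Y\<close> with the same limit \<open>x\<close>, each member \<open>v\<close> of
  which controls a tail of \<open>(x\<^sub>\<lambda>)\<close> from the left.

  The indices of the new net are triples \<open>(v, e, F)\<close>, to be thought of as formal balls: \<open>v \<in> Y\<close> is
  a centre, \<open>e\<close> is a radius strictly larger than \<open>limsup d(v, x\<^sub>\<lambda>)\<close>, and \<open>F\<close> is a finite set of
  strict lower bounds \<open>a < d(x, c)\<close> that \<open>v\<close> is required to satisfy as well. A ball
  precedes another if \<open>d(v, v') + e' \<le> e\<close> and \<open>F \<subseteq> F'\<close>; this is transitive by the triangle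
  inequality, and makes the net of centres Cauchy as the radii shrink. The lower bound for
  \<open>d(c, v)\<close> that makes \<open>x\<close> a limit of the centres comes from
  \<open>d(c, x) \<le> d(c, v) + d(v, x)\<close> and \<open>d(v, x) \<le> e\<close>. The one for \<open>d(v, c)\<close> cannot be had
  in the same way, as nothing makes \<open>d(x, v)\<close> small; it is what the sets \<open>F\<close> enforce.

  The continuity hypothesis is applied to the new net at the end (\<open>tendsto_dist_of_mem\<close>), but it is
  also what makes that net directed (\<open>exists_common_approximant\<close>). Given finitely many
  balls, a late \<open>x\<^sub>\<lambda>\<close> lies in all of them. As \<open>x\<^sub>\<lambda>\<close> is itself a limit of a Cauchy net
  \<open>(v\<^sub>\<mu>)\<close> in \<open>Y\<close>, the hypothesis says that \<open>d(w, v\<^sub>\<mu>)\<close> tends to \<open>d(w, x\<^sub>\<lambda>)\<close> for each centre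
  \<open>w \<in> Y\<close>, so a late \<open>v\<^sub>\<mu>\<close> lies in all of the balls too.

  Algebraicity then holds because \<open>cauchy_limits\<close> is monotone in the set that contains the nets.
\<close>

section \<open>Cauchy nets and their limits\<close>

lemma net_filter_not_bot:
  assumes "net_index_set \<Lambda> R"
  shows "net_filter \<Lambda> R \<noteq> bot"
proof
  assume "net_filter \<Lambda> R = bot"
  then have "\<exists>\<gamma>\<in>\<Lambda>. \<forall>l\<in>net_succs \<Lambda> R \<gamma>. False"
    using eventually_net_filter[OF assms, of "\<lambda>_. False"] by simp
  then show False using assms unfolding net_index_set_def net_succs_def by blast
qed

lemma eventually_net_succs:
  assumes "net_index_set \<Lambda> R" "\<gamma> \<in> \<Lambda>"
  shows "\<forall>\<^sub>F l in net_filter \<Lambda> R. l \<in> net_succs \<Lambda> R \<gamma>"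
  using assms by (auto simp: eventually_net_filter)

lemma eventually_mem_net:
  assumes "net_index_set \<Lambda> R"
  shows "\<forall>\<^sub>F l in net_filter \<Lambda> R. l \<in> \<Lambda>"
  using assms by (auto simp: eventually_net_filter net_succs_def net_index_set_def)

lemma net_cauchy_eventually:
  assumes net: "net_index_set \<Lambda> R" and "net_cauchy d \<Lambda> R u" and "0 < e"
  shows "\<forall>\<^sub>F \<gamma> in net_filter \<Lambda> R. \<forall>\<^sub>F \<delta> in net_filter \<Lambda> R. d (u \<gamma>) (u \<delta>) < e"
proof -
  have "\<forall>\<^sub>F \<gamma> in net_filter \<Lambda> R. (SUP \<delta>\<in>net_succs \<Lambda> R \<gamma>. d (u \<gamma>) (u \<delta>)) < e"
    using assms unfolding net_cauchy_def by (auto dest: order_tendstoD(2))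
  with eventually_mem_net[OF net] show ?thesis
  proof eventually_elim
    case (elim \<gamma>)
    show ?case
      using eventually_net_succs[OF net elim(1)]
    proof eventually_elim
      case (elim \<delta>)
      then show ?case
        using \<open>(SUP \<delta>\<in>net_succs \<Lambda> R \<gamma>. d (u \<gamma>) (u \<delta>)) < e\<close> by (meson SUP_upper le_less_trans)
    qed
  qed
qed

lemma net_limit_eventually_greater:
  assumes "net_limit X d \<Lambda> R u x" "c \<in> X"
  shows "a < d x c \<Longrightarrow> \<forall>\<^sub>F l in net_filter \<Lambda> R. a < d (u l) c"
    and "a < d c x \<Longrightarrow> \<forall>\<^sub>F l in net_filter \<Lambda> R. a < d c (u l)"
  using assms unfolding net_limit_def le_Liminf_iff by auto

lemma net_limit_dist_le:
  assumes "net_index_set \<Lambda> R" "net_limit X d \<Lambda> R u x" "c \<in> X"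
    and "\<forall>\<^sub>F l in net_filter \<Lambda> R. d c (u l) \<le> b"
  shows "d c x \<le> b"
proof (rule ccontr)
  assume "\<not> d c x \<le> b"
  then have "\<forall>\<^sub>F l in net_filter \<Lambda> R. b < d c (u l)"
    using net_limit_eventually_greater(2)[OF assms(2,3)] by (simp add: not_le)
  with assms(4) have "\<forall>\<^sub>F l in net_filter \<Lambda> R. False"
    by eventually_elim simp
  then show False using net_filter_not_bot[OF assms(1)] by simp
qed

text \<open>
  Although a limit is defined by lower bounds only, a Cauchy net does approach it from the left:
  \<open>d(u\<^sub>\<gamma>, x)\<close> is at most \<open>liminf d(u\<^sub>\<gamma>, u\<^sub>\<delta>)\<close>, which is small for late \<open>\<gamma>\<close>.
\<close>

lemma cauchy_net_eventually_close:
  assumes net: "net_index_set \<Lambda> R" and "u ` \<Lambda> \<subseteq> X" "net_cauchy d \<Lambda> R u" "net_limit X d \<Lambda> R u x"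
    and "0 < e"
  shows "\<forall>\<^sub>F l in net_filter \<Lambda> R. d (u l) x < e"
proof -
  obtain e' where e': "0 < e'" "e' < e" using dense[OF \<open>0 < e\<close>] by blast
  from net_cauchy_eventually[OF net assms(3) e'(1)] eventually_mem_net[OF net]
  show ?thesis
  proof eventually_elim
    case (elim l)
    have "d (u l) x \<le> e'"
      using net assms(4)
    proof (rule net_limit_dist_le)
      show "u l \<in> X" using elim assms(2) by blast
      show "\<forall>\<^sub>F m in net_filter \<Lambda> R. d (u l) (u m) \<le> e'"
        using elim(1) by (rule eventually_mono) simp
    qed
    with e' show ?case by simp
  qed
qed

section \<open>Approximating a net from a dense subset\<close>

locale cauchy_net_over_dense_subset =
  fixes X Y :: "'a set" and d :: "'a \<Rightarrow> 'a \<Rightarrow> ennreal"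
    and \<Lambda> :: "'i set" and R u x
  assumes dist: "distance_on X d" and YX: "Y \<subseteq> X"
    and dense: "X \<subseteq> cauchy_limits X d Y"
    and cont: "\<And>y (\<Lambda> :: 'a net_index set) R u x.
           y \<in> Y \<Longrightarrow> net_index_set \<Lambda> R \<Longrightarrow> u ` \<Lambda> \<subseteq> Y \<Longrightarrow>
           net_cauchy d \<Lambda> R u \<Longrightarrow> net_limit X d \<Lambda> R u x \<Longrightarrow>
           ((\<lambda>l. d y (u l)) \<longlongrightarrow> d y x) (net_filter \<Lambda> R)"
    and net: "net_index_set \<Lambda> R" and uX: "u ` \<Lambda> \<subseteq> X"
    and cauchy: "net_cauchy d \<Lambda> R u" and lim: "net_limit X d \<Lambda> R u x"
begin

text \<open>
  The set \<open>W\<close> consists of open balls that contain a tail of the net \<open>u\<close>, and \<open>F\<close> of lower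
  bounds that are to be met. The required \<open>v\<close> is a late term of a Cauchy net in \<open>Y\<close> converging to
  a late term \<open>u\<^sub>l\<close>. The conditions given by \<open>W\<close> and \<open>F\<close> are finitely many strict inequalities
  that hold for \<open>u\<^sub>l\<close>; they pass to late terms of the net in \<open>Y\<close>, those in \<open>W\<close> by the
  continuity hypothesis and those in \<open>F\<close> by the definition of a limit. The radius \<open>e\<close> is split
  between \<open>d(v, u\<^sub>l)\<close> and the oscillation of \<open>u\<close> beyond \<open>l\<close>.
\<close>

lemma exists_common_approximant:
  assumes W: "finite W" "\<And>w r. (w, r) \<in> W \<Longrightarrow> w \<in> Y \<and> (\<forall>\<^sub>F l in net_filter \<Lambda> R. d w (u l) < r)"
    and F: "finite F" "\<And>c a. (c, a) \<in> F \<Longrightarrow> c \<in> X \<and> a < d x c"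
    and e: "0 < e"
  shows "\<exists>v\<in>Y. (\<forall>(w, r)\<in>W. d w v < r) \<and> (\<forall>(c, a)\<in>F. a < d v c)
    \<and> (\<forall>\<^sub>F l in net_filter \<Lambda> R. d v (u l) < e)"
proof -
  let ?N = "net_filter \<Lambda> R"
  have half: "0 < e / 2" "e / 2 + e / 2 = e"
    using e by (simp_all add: ennreal_zero_less_divide ennreal_times_divide mult_divide_eq_ennreal
        mult.commute[of 2] flip: mult_2)
  have "\<forall>\<^sub>F l in ?N. \<forall>(w, r)\<in>W. d w (u l) < r"
    using W by (auto intro!: eventually_ball_finite)
  moreover have "\<forall>\<^sub>F l in ?N. \<forall>(c, a)\<in>F. a < d (u l) c"
    using F net_limit_eventually_greater(1)[OF lim] by (auto intro!: eventually_ball_finite)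
  ultimately have "\<forall>\<^sub>F l in ?N. l \<in> \<Lambda> \<and> (\<forall>(w, r)\<in>W. d w (u l) < r) \<and> (\<forall>(c, a)\<in>F. a < d (u l) c)
      \<and> (\<forall>\<^sub>F m in ?N. d (u l) (u m) < e / 2)"
    using eventually_mem_net[OF net] net_cauchy_eventually[OF net cauchy half(1)]
    by eventually_elim blast
  then obtain l where l: "l \<in> \<Lambda>" "\<And>w r. (w, r) \<in> W \<Longrightarrow> d w (u l) < r"
      "\<And>c a. (c, a) \<in> F \<Longrightarrow> a < d (u l) c" "\<forall>\<^sub>F m in ?N. d (u l) (u m) < e / 2"
    using eventually_happens'[OF net_filter_not_bot[OF net]] by fast
  have "u l \<in> X" using l(1) uX by blast
  then obtain M :: "'a net_index set" and S z where M: "net_index_set M S" "z ` M \<subseteq> Y"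
      "net_cauchy d M S z" "net_limit X d M S z (u l)"
    using dense unfolding cauchy_limits_def by blast
  let ?G = "net_filter M S"
  have "\<forall>\<^sub>F k in ?G. \<forall>(w, r)\<in>W. d w (z k) < r"
    using W l(2) order_tendstoD(2)[OF cont[OF _ M]] by (auto intro!: eventually_ball_finite)
  moreover have "\<forall>\<^sub>F k in ?G. \<forall>(c, a)\<in>F. a < d (z k) c"
    using F l(3) net_limit_eventually_greater(1)[OF M(4)] by (auto intro!: eventually_ball_finite)
  ultimately have "\<forall>\<^sub>F k in ?G. k \<in> M \<and> (\<forall>(w, r)\<in>W. d w (z k) < r) \<and> (\<forall>(c, a)\<in>F. a < d (z k) c)
      \<and> d (z k) (u l) < e / 2"
    using eventually_mem_net[OF M(1)]
      cauchy_net_eventually_close[OF M(1) order_trans[OF M(2) YX] M(3,4) half(1)]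
    by eventually_elim blast
  then obtain k where k: "k \<in> M" "\<And>w r. (w, r) \<in> W \<Longrightarrow> d w (z k) < r"
      "\<And>c a. (c, a) \<in> F \<Longrightarrow> a < d (z k) c" "d (z k) (u l) < e / 2"
    using eventually_happens'[OF net_filter_not_bot[OF M(1)]] by fast
  have zY: "z k \<in> Y" using k(1) M(2) by blast
  have "\<forall>\<^sub>F m in ?N. d (z k) (u m) < e"
    using l(4) eventually_mem_net[OF net]
  proof eventually_elim
    case (elim m)
    have "d (z k) (u m) \<le> d (z k) (u l) + d (u l) (u m)"
      using dist zY YX \<open>u l \<in> X\<close> elim(2) uX unfolding distance_on_def by blast
    also have "\<dots> < e / 2 + e / 2"
      using k(4) elim(1) by (rule add_strict_mono)
    finally show ?case using half(2) by simp
  qed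
  with zY k(2,3) show ?thesis by blast
qed

end

section \<open>The net of formal balls\<close>

text \<open>
  The radius must exceed \<open>limsup d(v, u\<^sub>l)\<close> strictly, so that a smaller ball around a nearby centre
  fits inside; the intermediate number \<open>r\<close> expresses this.
\<close>

definition tail_balls :: "'a set \<Rightarrow> 'a set \<Rightarrow> ('a \<Rightarrow> 'a \<Rightarrow> ennreal) \<Rightarrow> 'i filter \<Rightarrow> ('i \<Rightarrow> 'a) \<Rightarrow> 'a \<Rightarrow>
    ('a \<times> ennreal \<times> ('a \<times> ennreal) set) set" where
  "tail_balls X Y d N u x = {(v, e, F). v \<in> Y \<and> (\<exists>r<e. \<forall>\<^sub>F l in N. d v (u l) < r) \<and>
     finite F \<and> (\<forall>(c, a)\<in>F. c \<in> X \<and> a < d x c \<and> a < d v c)}"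

definition ball_refines :: "('a \<Rightarrow> 'a \<Rightarrow> ennreal) \<Rightarrow> 'a \<times> ennreal \<times> ('a \<times> ennreal) set \<Rightarrow>
    'a \<times> ennreal \<times> ('a \<times> ennreal) set \<Rightarrow> bool" where
  "ball_refines d = (\<lambda>(v, e, F) (v', e', F'). d v v' + e' \<le> e \<and> F \<subseteq> F')"

lemma tail_balls_iff:
  "(v, e, F) \<in> tail_balls X Y d N u x \<longleftrightarrow> v \<in> Y \<and> (\<exists>r<e. \<forall>\<^sub>F l in N. d v (u l) < r) \<and>
     finite F \<and> (\<forall>(c, a)\<in>F. c \<in> X \<and> a < d x c \<and> a < d v c)"
  by (simp add: tail_balls_def)

lemma ball_refines_iff:
  "ball_refines d (v, e, F) (v', e', F') \<longleftrightarrow> d v v' + e' \<le> e \<and> F \<subseteq> F'"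
  by (simp add: ball_refines_def)

context cauchy_net_over_dense_subset
begin

text \<open>
  Directedness is an application of \<open>exists_common_approximant\<close>, the sets \<open>W\<close> and \<open>F\<close> being
  read off from two given balls. Applied to \<open>W = {}\<close>, the same lemma gives balls of
  arbitrarily small radius and balls with any prescribed bounds, and a property of one ball that
  passes to its refinements holds eventually.
\<close>

lemma net_of_centres:
  defines "B \<equiv> tail_balls X Y d (net_filter \<Lambda> R) u x"
  shows "net_index_set B (ball_refines d)" "net_cauchy d B (ball_refines d) fst"
    "net_limit X d B (ball_refines d) fst x"
    "0 < e \<Longrightarrow> \<forall>\<^sub>F b in net_filter B (ball_refines d). \<forall>\<^sub>F l in net_filter \<Lambda> R. d (fst b) (u l) < e"
proof -
  let ?N = "net_filter \<Lambda> R" and ?Q = "ball_refines d"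
  have tri: "d p q \<le> d p s + d s q" if "p \<in> X" "q \<in> X" "s \<in> X" for p q s
    using dist that unfolding distance_on_def by blast
  have xX: "x \<in> X" using lim by (simp add: net_limit_def)
  have initial: "\<exists>v. (v, e, F) \<in> B"
    if F: "finite F" "\<And>c a. (c, a) \<in> F \<Longrightarrow> c \<in> X \<and> a < d x c" and "0 < e" for e F
  proof -
    obtain r where r: "0 < r" "r < e" using Orderings.dense[OF \<open>0 < e\<close>] by blast
    obtain v where "v \<in> Y" "\<forall>(c, a)\<in>F. a < d v c" "\<forall>\<^sub>F l in ?N. d v (u l) < r"
      using exists_common_approximant[of "{}" F r] F r(1) by auto
    then have "(v, e, F) \<in> B"
      using r(2) F unfolding B_def tail_balls_iff by blast
    then show ?thesis ..
  qed
  show index: "net_index_set B ?Q"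
    unfolding net_index_set_def
  proof (intro conjI ballI)
    have "\<exists>v. (v, 1, {}) \<in> B" by (rule initial) auto
    then show "B \<noteq> {}" by blast
    show "transp_on B ?Q"
    proof (rule transp_onI)
      fix b b' b'' assume B: "b \<in> B" "b' \<in> B" "b'' \<in> B" and Q: "?Q b b'" "?Q b' b''"
      obtain v e F v' e' F' v'' e'' F'' where b: "b = (v, e, F)" "b' = (v', e', F')"
        "b'' = (v'', e'', F'')" by (cases b; cases b'; cases b'') blast
      have "v \<in> X" "v' \<in> X" "v'' \<in> X" using B YX unfolding b B_def tail_balls_iff by blast+
      then have "d v v'' + e'' \<le> d v v' + d v' v'' + e''" by (intro add_right_mono tri)
      also have "\<dots> = d v v' + (d v' v'' + e'')" by (simp add: add.assoc)
      also have "\<dots> \<le> d v v' + e'"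
        using Q(2) unfolding b ball_refines_iff by (intro add_left_mono) simp
      also have "\<dots> \<le> e" using Q(1) unfolding b ball_refines_iff by simp
      finally show "?Q b b''" using Q unfolding b ball_refines_iff by blast
    qed
    fix b b' assume B: "b \<in> B" "b' \<in> B"
    obtain v e F v' e' F' where b: "b = (v, e, F)" "b' = (v', e', F')" by (cases b; cases b') blast
    obtain r where r: "r < e" "\<forall>\<^sub>F l in ?N. d v (u l) < r"
      using B(1) unfolding b B_def tail_balls_iff by blast
    obtain r' where r': "r' < e'" "\<forall>\<^sub>F l in ?N. d v' (u l) < r'"
      using B(2) unfolding b B_def tail_balls_iff by blast
    \<comment> \<open>The new radius is the smaller of the two gaps, so that any centre within \<open>r\<close> of \<open>v\<close> and
      within \<open>r'\<close> of \<open>v'\<close> gives a refinement of both balls.\<close>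
    define g where "g = min (e - r) (e' - r')"
    have g: "0 < g" "r + g \<le> e" "r' + g \<le> e'"
    proof -
      show "0 < g" using r(1) r'(1) unfolding g_def by (simp add: diff_gr0_ennreal)
      have "r + g \<le> r + (e - r)" unfolding g_def by (intro add_left_mono) simp
      then show "r + g \<le> e" using r(1) by (simp add: add_diff_inverse_ennreal)
      have "r' + g \<le> r' + (e' - r')" unfolding g_def by (intro add_left_mono) simp
      then show "r' + g \<le> e'" using r'(1) by (simp add: add_diff_inverse_ennreal)
    qed
    obtain s where s: "0 < s" "s < g" using Orderings.dense[OF g(1)] by blast
    have FF: "finite (F \<union> F')" "\<And>c a. (c, a) \<in> F \<union> F' \<Longrightarrow> c \<in> X \<and> a < d x c"
      using B unfolding b B_def tail_balls_iff by auto
    have "\<exists>z\<in>Y. (\<forall>(w, r)\<in>{(v, r), (v', r')}. d w z < r) \<and> (\<forall>(c, a)\<in>F \<union> F'. a < d z c)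
        \<and> (\<forall>\<^sub>F l in ?N. d z (u l) < s)"
      using r(2) r'(2) s(1) FF B by (intro exists_common_approximant) (auto simp: b B_def tail_balls_iff)
    then obtain z where z: "z \<in> Y" "d v z < r" "d v' z < r'" "\<forall>(c, a)\<in>F \<union> F'. a < d z c"
        "\<forall>\<^sub>F l in ?N. d z (u l) < s" by auto
    have "(z, g, F \<union> F') \<in> B"
      using z s(2) FF unfolding B_def tail_balls_iff by blast
    moreover have "d v z + g \<le> e" "d v' z + g \<le> e'"
      using z(2,3) g(2,3) by (meson add_right_mono less_imp_le order_trans)+
    ultimately show "\<exists>b''\<in>B. ?Q b b'' \<and> ?Q b' b''"
      unfolding b by (intro bexI[of _ "(z, g, F \<union> F')"]) (auto simp: ball_refines_iff)
  qed
  have ev_small: "\<forall>\<^sub>F b in net_filter B ?Q. b \<in> B \<and> fst (snd b) \<le> e" if "0 < e" for e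
  proof -
    have "\<exists>v. (v, e, {}) \<in> B" by (rule initial) (use that in auto)
    then obtain v where v: "(v, e, {}) \<in> B" ..
    show ?thesis
      using eventually_net_succs[OF index v]
    proof eventually_elim
      case (elim b)
      obtain v' e' F' where b: "b = (v', e', F')" by (cases b)
      have "d v v' + e' \<le> e" using elim unfolding net_succs_def b by (simp add: ball_refines_iff)
      then have "e' \<le> e" by (metis add_left_mono add.commute add_0 order_trans zero_le)
      then show ?case using elim unfolding net_succs_def b by simp
    qed
  qed
  show close: "\<forall>\<^sub>F b in net_filter B ?Q. \<forall>\<^sub>F l in ?N. d (fst b) (u l) < e" if "0 < e" for e
    using ev_small[OF that]
  proof eventually_elim
    case (elim b)
    obtain v' e' F' where b: "b = (v', e', F')" by (cases b)
    obtain r where r: "r < e'" "\<forall>\<^sub>F l in ?N. d v' (u l) < r"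
      using elim unfolding b B_def tail_balls_iff by blast
    have "r < e" using elim r(1) by (auto simp: b)
    show ?case using r(2) unfolding b by (rule eventually_mono) (use \<open>r < e\<close> in simp)
  qed
  show "net_cauchy d B ?Q fst"
    unfolding net_cauchy_def
  proof (rule order_tendstoI)
    fix e :: ennreal assume "0 < e"
    then obtain e0 where e0: "0 < e0" "e0 < e" using Orderings.dense by blast
    show "\<forall>\<^sub>F b in net_filter B ?Q. (SUP b'\<in>net_succs B ?Q b. d (fst b) (fst b')) < e"
      using ev_small[OF e0(1)]
    proof eventually_elim
      case (elim b)
      have "d (fst b) (fst b') \<le> e0" if "b' \<in> net_succs B ?Q b" for b'
      proof -
        have "d (fst b) (fst b') + fst (snd b') \<le> fst (snd b)"
          using that unfolding net_succs_def ball_refines_def by (auto simp: case_prod_beta)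
        then show ?thesis using elim by (meson le_iff_add order_trans)
      qed
      then have "(SUP b'\<in>net_succs B ?Q b. d (fst b) (fst b')) \<le> e0" by (rule SUP_least)
      with e0(2) show ?case by simp
    qed
  qed simp
  show "net_limit X d B ?Q fst x"
    unfolding net_limit_def
  proof (intro conjI ballI)
    show "x \<in> X" by (rule xX)
    fix c assume c: "c \<in> X"
    show "d x c \<le> Liminf (net_filter B ?Q) (\<lambda>b. d (fst b) c)"
      unfolding le_Liminf_iff
    proof (intro allI impI)
      fix a assume a: "a < d x c"
      \<comment> \<open>Past any ball whose list of bounds contains \<open>(c, a)\<close>, that bound holds by definition.\<close>
      have "\<exists>v. (v, 1, {(c, a)}) \<in> B" by (rule initial) (use a c in auto)
      then obtain v where v: "(v, 1, {(c, a)}) \<in> B" ..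
      show "\<forall>\<^sub>F b in net_filter B ?Q. a < d (fst b) c"
        using eventually_net_succs[OF index v]
      proof eventually_elim
        case (elim b)
        obtain v' e' F' where b: "b = (v', e', F')" by (cases b)
        have "(c, a) \<in> F'" "b \<in> B"
          using elim unfolding net_succs_def b by (auto simp: ball_refines_iff)
        then show ?case unfolding b B_def tail_balls_iff by auto
      qed
    qed
    \<comment> \<open>This bound comes from \<open>d c x \<le> d c v + d v x\<close>, where \<open>d v x\<close> is eventually small.\<close>
    show "d c x \<le> Liminf (net_filter B ?Q) (\<lambda>b. d c (fst b))"
    proof (rule ennreal_le_epsilon)
      fix e :: real assume "0 < e"
      then have e: "0 < ennreal e" by simp
      have "\<forall>\<^sub>F b in net_filter B ?Q. d c x - e \<le> d c (fst b)"
        using close[OF e] eventually_mem_net[OF index]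
      proof eventually_elim
        case (elim b)
        have vX: "fst b \<in> X" using elim(2) YX unfolding B_def tail_balls_def by auto
        have "d (fst b) x \<le> ennreal e"
          by (rule net_limit_dist_le[OF net lim vX]) (rule eventually_mono[OF elim(1)], simp)
        then have "d c x \<le> d c (fst b) + e"
          using tri[OF c xX vX] by (meson add_left_mono order_trans)
        then show ?case by (simp add: ennreal_minus_le_iff add.commute)
      qed
      then have "d c x - e \<le> Liminf (net_filter B ?Q) (\<lambda>b. d c (fst b))"
        by (rule Liminf_bounded)
      then show "d c x \<le> Liminf (net_filter B ?Q) (\<lambda>b. d c (fst b)) + ennreal e"
        by (simp add: ennreal_minus_le_iff add.commute)
    qed
  qed
qed

end

section \<open>Finiteness of the dense subset\<close>

text \<open>
  A centre \<open>v\<close> of a late ball has \<open>d(y, v)\<close> close to \<open>d(y, x)\<close>, since the net of centres lies in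
  \<open>Y\<close> and converges to \<open>x\<close>, and \<open>d(v, u\<^sub>l)\<close> eventually small by construction. The triangle
  inequality through \<open>v\<close> then gives the missing upper bound on \<open>d(y, u\<^sub>l)\<close>.
\<close>

lemma (in cauchy_net_over_dense_subset) tendsto_dist_of_mem:
  assumes y: "y \<in> Y"
  shows "((\<lambda>l. d y (u l)) \<longlongrightarrow> d y x) (net_filter \<Lambda> R)"
proof (rule order_tendstoI)
  have yX: "y \<in> X" using y YX by blast
  show "\<forall>\<^sub>F l in net_filter \<Lambda> R. a < d y (u l)" if "a < d y x" for a
    using net_limit_eventually_greater(2)[OF lim yX that] .
  fix a assume a: "d y x < a"
  define B where "B = tail_balls X Y d (net_filter \<Lambda> R) u x"
  let ?Q = "ball_refines d"
  note net' = net_of_centres[folded B_def]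
  have BY: "fst ` B \<subseteq> Y" unfolding B_def tail_balls_def by auto
  \<comment> \<open>The balls do not have the index type for which continuity is assumed, hence the reindexing
    rule.\<close>
  have conv: "((\<lambda>b. d y (fst b)) \<longlongrightarrow> d y x) (net_filter B ?Q)"
    using cont[OF y] net'(1) BY net'(2,3) by (rule tendsto_cauchy_nets_any_index)
  obtain a' where a': "d y x < a'" "a' < a" using Orderings.dense[OF a] by blast
  have gap: "0 < a - a'" using a'(2) by (simp add: diff_gr0_ennreal)
  have "\<forall>\<^sub>F b in net_filter B ?Q. b \<in> B \<and> d y (fst b) < a' \<and>
      (\<forall>\<^sub>F l in net_filter \<Lambda> R. d (fst b) (u l) < a - a')"
    using eventually_mem_net[OF net'(1)] order_tendstoD(2)[OF conv a'(1)] net'(4)[OF gap]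
    by eventually_elim blast
  then obtain b where b: "b \<in> B" "d y (fst b) < a'"
      "\<forall>\<^sub>F l in net_filter \<Lambda> R. d (fst b) (u l) < a - a'"
    using eventually_happens'[OF net_filter_not_bot[OF net'(1)]] by fast
  have bX: "fst b \<in> X" using b(1) BY YX by blast
  show "\<forall>\<^sub>F l in net_filter \<Lambda> R. d y (u l) < a"
    using b(3) eventually_mem_net[OF net]
  proof eventually_elim
    case (elim l)
    have "d y (u l) \<le> d y (fst b) + d (fst b) (u l)"
      using dist yX bX elim(2) uX unfolding distance_on_def by blast
    also have "\<dots> < a' + (a - a')"
      using b(2) elim(1) by (rule add_strict_mono)
    also have "\<dots> = a" using a'(2) by (simp add: add_diff_inverse_ennreal)
    finally show ?case .
  qed
qed

lemma cauchy_limits_subset: "cauchy_limits X d Y \<subseteq> X"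
  unfolding cauchy_limits_def net_limit_def by blast

lemma cauchy_limits_mono: "Y \<subseteq> Z \<Longrightarrow> cauchy_limits X d Y \<subseteq> cauchy_limits X d Z"
  unfolding cauchy_limits_def by blast

theorem theorem3:
  fixes X Y :: "'a set" and d :: "'a \<Rightarrow> 'a \<Rightarrow> ennreal"
  assumes "distance_on X d"
    and "Y \<subseteq> X"
    and "X = cauchy_limits X d Y"
    and "\<And>y (\<Lambda> :: 'a net_index set) R u x.
           y \<in> Y \<Longrightarrow> net_index_set \<Lambda> R \<Longrightarrow> u ` \<Lambda> \<subseteq> Y \<Longrightarrow>
           net_cauchy d \<Lambda> R u \<Longrightarrow> net_limit X d \<Lambda> R u x \<Longrightarrow>
           ((\<lambda>l. d y (u l)) \<longlongrightarrow> d y x) (net_filter \<Lambda> R)"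
  shows "Y \<subseteq> finite_elements X d \<and> algebraic_on X d"
proof
  show fin: "Y \<subseteq> finite_elements X d"
  proof
    fix y assume y: "y \<in> Y"
    have "((\<lambda>l. d y (u l)) \<longlongrightarrow> d y x) (net_filter \<Lambda> R)"
      if "net_index_set \<Lambda> R" "u ` \<Lambda> \<subseteq> X" "net_cauchy d \<Lambda> R u" "net_limit X d \<Lambda> R u x"
      for \<Lambda> :: "'a net_index set" and R u x
    proof -
      interpret cauchy_net_over_dense_subset X Y d \<Lambda> R u x
        using assms that by unfold_locales auto
      show ?thesis using y by (rule tendsto_dist_of_mem)
    qed
    with y assms(2) show "y \<in> finite_elements X d"
      unfolding finite_elements_def by blast
  qed
  show "algebraic_on X d"
    unfolding algebraic_on_def
    using assms(3) cauchy_limits_mono[OF fin, of X d] cauchy_limits_subset[of X d] by blast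
qed

end
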